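(* The only Lucas numbers that are squares of Fibonacci numbers (with positive indices) are $L_1 = F_1^2 = 1$, $L_1 = F_2^2 = 1$, and $L_3 = F_3^2 = 4$; that is, for positive integers $k, n$, the equation $L_k = F_n^2$ holds if and only if $(k,n) \in \{(1,1),\ (1,2),\ (3,3)\}$.
   Context: $(F_n)_{n\geqslant 0}$ is the Fibonacci sequence: $F_0=0$, $F_1=1$, $F_{n+1}=F_n+F_{n-1}$ for $n \geqslant 1$. $(L_n)_{n\geqslant 0}$ is the Lucas sequence: $L_0=2$, $L_1=1$, $L_{n+1}=L_n+L_{n-1}$ for $n\geqslant 1$. *)

theory Defs
  imports "HOL-Number_Theory.Fib"
begin

fun lucas :: "nat \<Rightarrow> nat" where
  "lucas 0 = 2"
| "lucas (Suc 0) = 1"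
| "lucas (Suc (Suc n)) = lucas (Suc n) + lucas n"

end

theory Submission
  imports Defs
begin

text \<open>
  Since \<open>5 F\<^sub>n\<^sup>2 = L\<^sub>2\<^sub>n \<plusminus> 2\<close>, the equation \<open>L\<^sub>k = F\<^sub>n\<^sup>2\<close> puts the Lucas number \<open>L\<^sub>2\<^sub>n\<close> within
  distance \<open>2\<close> of \<open>5 L\<^sub>k\<close>.  But \<open>5 L\<^sub>k - L\<^sub>k\<^sub>+\<^sub>3 = 2 L\<^sub>k\<^sub>-\<^sub>2\<close> and \<open>L\<^sub>k\<^sub>+\<^sub>4 - 5 L\<^sub>k = 3 L\<^sub>k\<^sub>-\<^sub>1\<close>, so
  for \<open>k \<ge> 4\<close> it would lie strictly between two consecutive Lucas numbers.
\<close>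

text \<open>Cassini's identity: replacing \<open>(a, b)\<close> by \<open>(a + b, a)\<close> negates
  the form \<open>a^2 - a b - b^2\<close>.\<close>

lemma fib_Suc_quadratic_form:
  "(int (fib (Suc n)))\<^sup>2 - int (fib (Suc n)) * int (fib n) - (int (fib n))\<^sup>2 = (-1) ^ n"
proof (induction n)
  case (Suc n)
  then show ?case
    by (simp add: power2_eq_square algebra_simps)
qed simp

text \<open>Both parities are carried jointly so that the recurrence closes the induction.\<close>

lemma lucas_double_fib:
  "int (lucas (2 * n)) =
     2 * (int (fib (Suc n)))\<^sup>2 - 2 * int (fib (Suc n)) * int (fib n) + 3 * (int (fib n))\<^sup>2
   \<and> int (lucas (Suc (2 * n))) =
     (int (fib (Suc n)))\<^sup>2 + 4 * int (fib (Suc n)) * int (fib n) - (int (fib n))\<^sup>2"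
proof (induction n)
  case (Suc n)
  then show ?case
    by (simp add: power2_eq_square algebra_simps)
qed simp

lemma lucas_double: "int (lucas (2 * n)) = 5 * (int (fib n))\<^sup>2 + 2 * (-1) ^ n"
  using lucas_double_fib[of n] fib_Suc_quadratic_form[of n] by linarith

lemma lucas_pos: "lucas n > 0"
  by (induction n rule: lucas.induct) auto

text \<open>The shift skips the initial descent from 2 to 1.\<close>

lemma strict_mono_lucas_Suc: "strict_mono (\<lambda>n. lucas (Suc n))"
  by (simp add: strict_mono_Suc_iff lucas_pos)

lemma lucas_ne_fib_square:
  assumes "k \<ge> 4" and "n > 0"
  shows "lucas k \<noteq> (fib n)\<^sup>2"
proof
  assume eq: "lucas k = (fib n)\<^sup>2"
  obtain j where k: "k = j + 4"
    using assms(1) le_Suc_ex by (metis add.commute)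
  obtain m where m: "2 * n = Suc m"
    using assms(2) by (cases "2 * n") auto
  \<comment> \<open>This makes the lower gap, twice \<open>lucas (k - 2)\<close>, at least 4, beyond
    the error 2.\<close>
  have "lucas (Suc 0) < lucas (Suc (Suc j))"
    using strict_mono_lucas_Suc by (rule strict_monoD) simp
  then have big: "lucas (Suc (Suc j)) \<ge> 2"
    by simp
  have "int (lucas (Suc m)) = 5 * int (lucas k) + 2 * (-1) ^ n"
    using lucas_double[of n] m eq by simp
  then have near: "lucas (Suc m) \<le> 5 * lucas k + 2" "5 * lucas k \<le> lucas (Suc m) + 2"
    by (cases "even n"; simp)+
  have "lucas (Suc (j + 6)) + 2 * lucas (Suc (Suc j)) = 5 * lucas k"
    and "lucas (Suc (j + 7)) = 5 * lucas k + 3 * lucas (Suc (Suc (Suc j)))"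
    by (simp_all add: k eval_nat_numeral)
  with near big lucas_pos[of "Suc j"]
  have "lucas (Suc (j + 6)) < lucas (Suc m)" "lucas (Suc m) < lucas (Suc (j + 7))"
    by simp_all
  then have "j + 6 < m" "m < j + 7"
    by (simp_all only: strict_mono_less[OF strict_mono_lucas_Suc])
  then show False
    by simp
qed

theorem corollary3:
  fixes k n :: nat
  assumes "k > 0" and "n > 0"
  shows "lucas k = (fib n)\<^sup>2 \<longleftrightarrow> (k, n) \<in> {(1, 1), (1, 2), (3, 3)}"
proof
  assume eq: "lucas k = (fib n)\<^sup>2"
  then have "k < 4"
    using lucas_ne_fib_square assms(2) by (meson not_le)
  then have k: "k = 1 \<or> k = 2 \<or> k = 3"
    using assms(1) by auto
  \<comment> \<open>Here \<open>lucas k\<close> is at most 4, while \<open>fib 4\<close> squared is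
    9.\<close>
  have "n < 4"
  proof (rule ccontr)
    assume "\<not> n < 4"
    then have "fib 4 \<le> fib n"
      by (intro fib_mono) simp
    then have "3\<^sup>2 \<le> (fib n)\<^sup>2"
      by (intro power_mono) (simp_all add: eval_nat_numeral)
    with k eq show False
      by (auto simp: eval_nat_numeral)
  qed
  then have "n = 1 \<or> n = 2 \<or> n = 3"
    using assms(2) by auto
  with k eq show "(k, n) \<in> {(1, 1), (1, 2), (3, 3)}"
    by (auto simp: eval_nat_numeral)
qed (auto simp: eval_nat_numeral)

end
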